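(* Let $\{l_i=v_i\}_{i\in I}$ and $\{l_j=w_j\}_{j\in J}$ be two records (with $v_i,w_j$ values). If $k$ is an index with $k\in I$ and $k\notin J$, then $\{l_i=v_i\}_{i\in I}\not\equiv\{l_j=w_j\}_{j\in J}$.
   Context: Fix pairwise disjoint countably infinite sets of $\lambda$-variables ($x,y,\dots$), stack variables ($\alpha,\beta,\dots$), term variables ($a,b,\dots$), and countable sets of labels $l$ (indexed, with distinct indices denoting distinct labels) and constructors $C$. Values, terms, stacks, processes: $v,w::=x\mid\lambda x\,t\mid C[v]\mid\{l_i=v_i\}_{i\in I}$; $t,u::=a\mid v\mid t\,u\mid\mu\alpha\,t\mid p\mid v.l\mid\mathrm{case}_v[C_i[x_i]\to t_i]_{i\in I}\mid\delta_{v,w}$; $\pi::=\alpha\mid v.\pi\mid[t]\pi$; $p::=t\ast\pi$; $I$ finite; $\lambda x$, $\mu\alpha$ and the $x_i$ in case branches are binders, term variables are never bound. Substitutions map $\lambda$-variables to values, stack variables to stacks, term variables to terms (capture-avoiding). $\succ$ is the smallest relation on processes with: $t\,u\ast\pi\succ u\ast[t]\pi$; $v\ast[t]\pi\succ t\ast v.\pi$; $\lambda x\,t\ast v.\pi\succ t[x:=v]\ast\pi$; $\mu\alpha\,t\ast\pi\succ t[\alpha:=\pi]\ast\pi$; $p\ast\pi\succ p$; $\{l_i=v_i\}_{i\in I}.l_k\ast\pi\succ v_k\ast\pi$ ($k\in I$); $\mathrm{case}_{C_k[v]}[C_i[x_i]\to t_i]_{i\in I}\ast\pi\succ t_k[x_k:=v]\ast\pi$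 ($k\in I$). A process is final if it is $v\ast\alpha$ with $v$ a value and $\alpha$ a stack variable; for a relation $R$, $p\Downarrow_R$ means $p\,R^*\,q$ with $q$ final. For $i\in\mathbb N$, inductively: $\rightsquigarrow_i=\succ\cup\{(\delta_{v,w}\ast\pi,v\ast\pi)\mid\exists j<i,\ v\not\equiv_jw\}$; $t\equiv_iu$ iff for all $j\le i$, stacks $\pi$, substitutions $\sigma$: $t\sigma\ast\pi\Downarrow_{\rightsquigarrow_j}\Leftrightarrow u\sigma\ast\pi\Downarrow_{\rightsquigarrow_j}$; $\not\equiv_i$ is its negation. $\equiv=\bigcap_i\equiv_i$ and $\not\equiv$ is its negation. *)

theory Defs
  imports Main "HOL-Library.Countable" "HOL-Library.Finite_Map"
begin

text \<open>
  Syntax up to renaming of bound variables, in de Bruijn style with two separate index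
  spaces: \<open>Lam\<close> and every branch of \<open>Case\<close> bind \<lambda>-variable \<open>0\<close>, and \<open>Mu\<close> binds stack
  variable \<open>0\<close>. Term variables are never bound, so \<open>TVar n\<close> is just a name.

  A record \<open>{l_i = v_i}\<close> with \<open>i\<close> ranging over a finite \<open>I\<close> is a finite map from labels to
  values: a label serves as its own index, and \<open>I\<close> is the domain of the map. Likewise, the
  branches of a case analysis form a finite map from constructors to branch bodies.
\<close>

datatype ('l, 'c) val =
    Var nat
  | Lam "('l, 'c) trm"
  | Con 'c "('l, 'c) val"
  | Rec "('l, ('l, 'c) val) fmap"
and ('l, 'c) trm =
    TVar nat
  | Val "('l, 'c) val"
  | App "('l, 'c) trm" "('l, 'c) trm"
  | Mu "('l, 'c) trm"
  | Prc "('l, 'c) prc"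
  | Proj "('l, 'c) val" 'l
  | Case "('l, 'c) val" "('c, ('l, 'c) trm) fmap"
  | Delta "('l, 'c) val" "('l, 'c) val"
and ('l, 'c) stk =
    SVar nat
  | Push "('l, 'c) val" "('l, 'c) stk"
  | Frame "('l, 'c) trm" "('l, 'c) stk"
and ('l, 'c) prc =
    Mk "('l, 'c) trm" "('l, 'c) stk"  (infix \<open>\<star>\<close> 55)

text \<open>Renaming of \<lambda>-variables by \<open>r\<close> and of stack variables by \<open>s\<close>.\<close>

definition up_ren :: "(nat \<Rightarrow> nat) \<Rightarrow> nat \<Rightarrow> nat" where
  "up_ren r = case_nat 0 (\<lambda>n. Suc (r n))"

primrec ren_val :: "(nat \<Rightarrow> nat) \<Rightarrow> (nat \<Rightarrow> nat) \<Rightarrow> ('l, 'c) val \<Rightarrow> ('l, 'c) val"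
  and ren_trm :: "(nat \<Rightarrow> nat) \<Rightarrow> (nat \<Rightarrow> nat) \<Rightarrow> ('l, 'c) trm \<Rightarrow> ('l, 'c) trm"
  and ren_stk :: "(nat \<Rightarrow> nat) \<Rightarrow> (nat \<Rightarrow> nat) \<Rightarrow> ('l, 'c) stk \<Rightarrow> ('l, 'c) stk"
  and ren_prc :: "(nat \<Rightarrow> nat) \<Rightarrow> (nat \<Rightarrow> nat) \<Rightarrow> ('l, 'c) prc \<Rightarrow> ('l, 'c) prc"
  where
  "ren_val r s (Var n) = Var (r n)"
| "ren_val r s (Lam t) = Lam (ren_trm (up_ren r) s t)"
| "ren_val r s (Con c v) = Con c (ren_val r s v)"
| "ren_val r s (Rec m) = Rec (fmmap (ren_val r s) m)"
| "ren_trm r s (TVar n) = TVar n"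
| "ren_trm r s (Val v) = Val (ren_val r s v)"
| "ren_trm r s (App t u) = App (ren_trm r s t) (ren_trm r s u)"
| "ren_trm r s (Mu t) = Mu (ren_trm r (up_ren s) t)"
| "ren_trm r s (Prc p) = Prc (ren_prc r s p)"
| "ren_trm r s (Proj v l) = Proj (ren_val r s v) l"
| "ren_trm r s (Case v m) = Case (ren_val r s v) (fmmap (ren_trm (up_ren r) s) m)"
| "ren_trm r s (Delta v w) = Delta (ren_val r s v) (ren_val r s w)"
| "ren_stk r s (SVar n) = SVar (s n)"
| "ren_stk r s (Push v \<pi>) = Push (ren_val r s v) (ren_stk r s \<pi>)"
| "ren_stk r s (Frame t \<pi>) = Frame (ren_trm r s t) (ren_stk r s \<pi>)"
| "ren_prc r s (t \<star> \<pi>) = ren_trm r s t \<star> ren_stk r s \<pi>"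

text \<open>
  A substitution has three components: \<open>f\<close> for \<lambda>-variables, \<open>g\<close> for stack variables and
  \<open>h\<close> for term variables. Since the images of all three may contain free \<lambda>- and stack
  variables, all three are shifted when a binder of either kind is crossed.
\<close>

record ('l, 'c) subst =
  on_lam :: "nat \<Rightarrow> ('l, 'c) val"
  on_stk :: "nat \<Rightarrow> ('l, 'c) stk"
  on_trm :: "nat \<Rightarrow> ('l, 'c) trm"

definition up_lam :: "('l, 'c) subst \<Rightarrow> ('l, 'c) subst" where
  "up_lam \<sigma> =
    \<lparr>on_lam = case_nat (Var 0) (\<lambda>n. ren_val Suc id (on_lam \<sigma> n)),
     on_stk = (\<lambda>n. ren_stk Suc id (on_stk \<sigma> n)),
     on_trm = (\<lambda>n. ren_trm Suc id (on_trm \<sigma> n))\<rparr>"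

definition up_mu :: "('l, 'c) subst \<Rightarrow> ('l, 'c) subst" where
  "up_mu \<sigma> =
    \<lparr>on_lam = (\<lambda>n. ren_val id Suc (on_lam \<sigma> n)),
     on_stk = case_nat (SVar 0) (\<lambda>n. ren_stk id Suc (on_stk \<sigma> n)),
     on_trm = (\<lambda>n. ren_trm id Suc (on_trm \<sigma> n))\<rparr>"

primrec sub_val :: "('l, 'c) subst \<Rightarrow> ('l, 'c) val \<Rightarrow> ('l, 'c) val"
  and sub_trm :: "('l, 'c) subst \<Rightarrow> ('l, 'c) trm \<Rightarrow> ('l, 'c) trm"
  and sub_stk :: "('l, 'c) subst \<Rightarrow> ('l, 'c) stk \<Rightarrow> ('l, 'c) stk"
  and sub_prc :: "('l, 'c) subst \<Rightarrow> ('l, 'c) prc \<Rightarrow> ('l, 'c) prc"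
  where
  "sub_val \<sigma> (Var n) = on_lam \<sigma> n"
| "sub_val \<sigma> (Lam t) = Lam (sub_trm (up_lam \<sigma>) t)"
| "sub_val \<sigma> (Con c v) = Con c (sub_val \<sigma> v)"
| "sub_val \<sigma> (Rec m) = Rec (fmmap (sub_val \<sigma>) m)"
| "sub_trm \<sigma> (TVar n) = on_trm \<sigma> n"
| "sub_trm \<sigma> (Val v) = Val (sub_val \<sigma> v)"
| "sub_trm \<sigma> (App t u) = App (sub_trm \<sigma> t) (sub_trm \<sigma> u)"
| "sub_trm \<sigma> (Mu t) = Mu (sub_trm (up_mu \<sigma>) t)"
| "sub_trm \<sigma> (Prc p) = Prc (sub_prc \<sigma> p)"
| "sub_trm \<sigma> (Proj v l) = Proj (sub_val \<sigma> v) l"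
| "sub_trm \<sigma> (Case v m) = Case (sub_val \<sigma> v) (fmmap (sub_trm (up_lam \<sigma>)) m)"
| "sub_trm \<sigma> (Delta v w) = Delta (sub_val \<sigma> v) (sub_val \<sigma> w)"
| "sub_stk \<sigma> (SVar n) = on_stk \<sigma> n"
| "sub_stk \<sigma> (Push v \<pi>) = Push (sub_val \<sigma> v) (sub_stk \<sigma> \<pi>)"
| "sub_stk \<sigma> (Frame t \<pi>) = Frame (sub_trm \<sigma> t) (sub_stk \<sigma> \<pi>)"
| "sub_prc \<sigma> (t \<star> \<pi>) = sub_trm \<sigma> t \<star> sub_stk \<sigma> \<pi>"

text \<open>
  Instantiation of the outermost bound variable of a body; the indices of the remaining
  variables of that kind drop by one because their binder disappears.
\<close>

definition inst_lam :: "('l, 'c) trm \<Rightarrow> ('l, 'c) val \<Rightarrow> ('l, 'c) trm" where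
  "inst_lam t v = sub_trm \<lparr>on_lam = case_nat v Var, on_stk = SVar, on_trm = TVar\<rparr> t"

definition inst_mu :: "('l, 'c) trm \<Rightarrow> ('l, 'c) stk \<Rightarrow> ('l, 'c) trm" where
  "inst_mu t \<pi> = sub_trm \<lparr>on_lam = Var, on_stk = case_nat \<pi> SVar, on_trm = TVar\<rparr> t"

inductive red :: "('l, 'c) prc \<Rightarrow> ('l, 'c) prc \<Rightarrow> bool"  (infix \<open>\<succ>\<close> 50) where
  "App t u \<star> \<pi> \<succ> u \<star> Frame t \<pi>"
| "Val v \<star> Frame t \<pi> \<succ> t \<star> Push v \<pi>"
| "Val (Lam t) \<star> Push v \<pi> \<succ> inst_lam t v \<star> \<pi>"
| "Mu t \<star> \<pi> \<succ> inst_mu t \<pi> \<star> \<pi>"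
| "Prc p \<star> \<pi> \<succ> p"
| "fmlookup m l = Some v \<Longrightarrow> Proj (Rec m) l \<star> \<pi> \<succ> Val v \<star> \<pi>"
| "fmlookup m c = Some t \<Longrightarrow> Case (Con c v) m \<star> \<pi> \<succ> inst_lam t v \<star> \<pi>"

definition final :: "('l, 'c) prc \<Rightarrow> bool" where
  "final p \<longleftrightarrow> (\<exists>v \<alpha>. p = Val v \<star> SVar \<alpha>)"

definition converges :: "(('l, 'c) prc \<Rightarrow> ('l, 'c) prc \<Rightarrow> bool) \<Rightarrow> ('l, 'c) prc \<Rightarrow> bool" where
  "converges R p \<longleftrightarrow> (\<exists>q. R\<^sup>*\<^sup>* p q \<and> final q)"

text \<open>
  \<open>step i\<close> uses \<open>equiv_at j\<close> only for \<open>j < i\<close>, and \<open>equiv_at i\<close> uses \<open>step j\<close> only for \<open>j \<le> i\<close>.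
\<close>

context
  notes conj_cong [fundef_cong]
begin

function step :: "nat \<Rightarrow> ('l, 'c) prc \<Rightarrow> ('l, 'c) prc \<Rightarrow> bool"
  and equiv_at :: "nat \<Rightarrow> ('l, 'c) trm \<Rightarrow> ('l, 'c) trm \<Rightarrow> bool"
  where
  "step i p q \<longleftrightarrow>
     p \<succ> q \<or>
     (\<exists>v w \<pi>. p = Delta v w \<star> \<pi> \<and> q = Val v \<star> \<pi> \<and>
        (\<exists>j<i. \<not> equiv_at j (Val v) (Val w)))"
| "equiv_at i t u \<longleftrightarrow>
     (\<forall>j\<le>i. \<forall>\<pi> \<sigma>.
        converges (\<lambda>p q. step j p q) (sub_trm \<sigma> t \<star> \<pi>) \<longleftrightarrow>
        converges (\<lambda>p q. step j p q) (sub_trm \<sigma> u \<star> \<pi>))"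
  by pat_completeness auto
termination
  by (relation "measure (\<lambda>x. case x of Inl (i, _) \<Rightarrow> 2 * i | Inr (i, _) \<Rightarrow> Suc (2 * i))") auto

end

declare step.simps [simp del] equiv_at.simps [simp del]

definition obs_equiv :: "('l, 'c) trm \<Rightarrow> ('l, 'c) trm \<Rightarrow> bool"  (infix \<open>\<cong>\<close> 50) where
  "t \<cong> u \<longleftrightarrow> (\<forall>i. equiv_at i t u)"

end

theory Submission
  imports Defs
begin

text \<open>
  A context that projects its argument at \<open>k\<close> and then discards the result separates the
  two records already for \<open>\<equiv>\<^sub>0\<close>: it makes \<open>V\<close> converge and gets stuck at the projection on \<open>W\<close>.
\<close>

text \<open>No \<open>j < 0\<close> exists, so the \<open>Delta\<close> rule never fires at level
  0.\<close>

lemma step_0: "step 0 = (\<succ>)"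
  by (intro ext) (simp add: step.simps)

inductive_cases red_FrameE: "Val v \<star> Frame t \<pi> \<succ> p"
inductive_cases red_LamE: "Val (Lam t) \<star> Push v \<pi> \<succ> p"
inductive_cases red_ProjE: "Proj (Rec m) l \<star> \<pi> \<succ> p"

lemma converges_red: "p \<succ> q \<Longrightarrow> converges (\<succ>) q \<Longrightarrow> converges (\<succ>) p"
  unfolding converges_def by (meson converse_rtranclp_into_rtranclp)

lemma converges_final: "converges R (Val v \<star> SVar \<alpha>)"
  unfolding converges_def final_def by blast

text \<open>Since \<open>p\<close> is not final, a reduction from it to a final process takes at
  least one step, and determinism forces that step to reach \<open>q\<close>.\<close>

lemma converges_red_iff:
  assumes "p \<succ> q" and "\<And>q'. p \<succ> q' \<Longrightarrow> q' = q" and "\<not> final p"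
  shows "converges (\<succ>) p \<longleftrightarrow> converges (\<succ>) q"
proof
  assume "converges (\<succ>) p"
  then obtain r where "(\<succ>)\<^sup>*\<^sup>* p r" "final r"
    unfolding converges_def by blast
  then show "converges (\<succ>) q"
    using assms(2,3) unfolding converges_def by (metis converse_rtranclpE)
qed (use assms(1) converges_red in blast)

lemma converges_Frame:
  "converges (\<succ>) (Val v \<star> Frame t \<pi>) \<longleftrightarrow> converges (\<succ>) (t \<star> Push v \<pi>)"
  by (rule converges_red_iff) (auto simp: final_def intro: red.intros elim: red_FrameE)

lemma converges_Lam:
  "converges (\<succ>) (Val (Lam t) \<star> Push v \<pi>) \<longleftrightarrow> converges (\<succ>) (inst_lam t v \<star> \<pi>)"
  by (rule converges_red_iff) (auto simp: final_def intro: red.intros elim: red_LamE)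

lemma converges_Proj:
  "converges (\<succ>) (Proj (Rec m) l \<star> \<pi>) \<longleftrightarrow>
    (\<exists>v. fmlookup m l = Some v \<and> converges (\<succ>) (Val v \<star> \<pi>))"
proof (cases "fmlookup m l")
  \<comment> \<open>With the label absent the projection is stuck, and it is not final
    either.\<close>
  case None
  have "\<not> final (Proj (Rec m) l \<star> \<pi>)"
    by (simp add: final_def)
  moreover have "\<not> Proj (Rec m) l \<star> \<pi> \<succ> q" for q
    using None by (auto elim: red_ProjE)
  ultimately show ?thesis
    using None unfolding converges_def by (auto elim: converse_rtranclpE)
next
  case (Some v)
  have "converges (\<succ>) (Proj (Rec m) l \<star> \<pi>) \<longleftrightarrow> converges (\<succ>) (Val v \<star> \<pi>)"
    by (rule converges_red_iff)
      (use Some in \<open>auto simp: final_def intro: red.intros elim: red_ProjE\<close>)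
  then show ?thesis
    using Some by simp
qed

text \<open>Projection applies to a value and is not a stack frame, so it is wrapped in an
  abstraction whose bound \<open>Var 0\<close> receives the record.\<close>

definition proj_test :: "'l \<Rightarrow> ('l, 'c) stk" where
  "proj_test k =
    Frame (Val (Lam (Proj (Var 0) k))) (Frame (Val (Lam (Val (Rec fmempty)))) (SVar 0))"

text \<open>The lookup is the only step that can fail: whatever value it yields, the second frame
  replaces it by the empty record on \<open>SVar 0\<close>, which is final.\<close>

lemma converges_proj_test:
  "converges (\<succ>) (Val (Rec m) \<star> proj_test k) \<longleftrightarrow> k |\<in>| fmdom m"
  unfolding proj_test_def converges_Frame converges_Lam
  by (simp add: inst_lam_def converges_Proj converges_Frame converges_Lam converges_final
      fmlookup_dom_iff)

theorem theorem12:
  fixes V W :: "('l::countable, ('l, 'c::countable) val) fmap"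
    and k :: 'l
  assumes "k |\<in>| fmdom V" and "k |\<notin>| fmdom W"
  shows "\<not> Val (Rec V) \<cong> Val (Rec W)"
proof
  \<comment> \<open>Substituting into a record preserves its domain, so any substitution will do.\<close>
  fix \<sigma> :: "('l, 'c) subst"
  assume "Val (Rec V) \<cong> Val (Rec W)"
  then have "equiv_at 0 (Val (Rec V)) (Val (Rec W))"
    unfolding obs_equiv_def by blast
  \<comment> \<open>At level 0 the bound leaves only \<open>j = 0\<close>; the stack is chosen to be
    \<open>proj_test k\<close>.\<close>
  then have "converges (\<succ>) (sub_trm \<sigma> (Val (Rec V)) \<star> proj_test k) \<longleftrightarrow>
      converges (\<succ>) (sub_trm \<sigma> (Val (Rec W)) \<star> proj_test k)"
    by (simp add: equiv_at.simps step_0)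
  then show False
    using assms by (simp add: converges_proj_test)
qed

end
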